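(* Let $n\ge1$ and $N\ge1$ be integers and let $0=\nu_1\le\nu_2\le\cdots\le\nu_n$ be integers. Then for all $z,w\in\mathbb{C}$, $$K_{n,N}(z,w)=\frac{\prod_{i=1}^n(\nu_i+1)_N}{\pi^n\,\Gamma(N)^n}\sqrt{\omega_{n,N}(z)\,\omega_{n,N}(w)}\;\;{}_nF_{n-1}\big(1-N,\ldots,1-N;\,1+\nu_2,\ldots,1+\nu_n;\,(-1)^n z\,\overline{w}\big),$$ where all $n$ upper parameters of ${}_nF_{n-1}$ are equal to $1-N$.
   Context: The weight $\omega_{n,N}$ is $$\omega_{n,N}(z)=\int_{\mathbb{C}^n}\prod_{j=1}^n\frac{|x_j|^{2\nu_j}}{(1+|x_j|^2)^{\nu_j+N+1}}\;\delta\Big(z-\prod_{j=1}^n x_j\Big)\,d^2x_1\cdots d^2x_n ,$$ where $d^2x$ is Lebesgue measure on $\mathbb{C}$ and $\delta$ is the Dirac delta on $\mathbb{C}$ (for $n=1$, $\omega_{1,N}(z)=(1+|z|^2)^{-N-1}$). The kernel is $$K_{n,N}(z,w)=\sqrt{\omega_{n,N}(z)\,\omega_{n,N}(w)}\;\sum_{k=0}^{N-1}p_k(z)\,\overline{p_k(w)},$$ where $p_0,\dots,p_{N-1}$ are the orthonormal polynomials ($\deg p_k=k$) with respect to the weight $\omega_{n,N}$, i.e. $\int_{\mathbb{C}}p_k(z)\overline{p_\ell(z)}\,\omega_{n,N}(z)\,d^2z=\delta_{k\ell}$. Explicitly, $$K_{n,N}(z,w)=\frac1{\pi^n}\sqrt{\omega_{n,N}(z)\,\omega_{n,N}(w)}\;\sum_{k=0}^{N-1}\frac1{\Gamma(N-k)^n}\prod_{i=1}^n\frac{\Gamma(\nu_i+N+1)}{\Gamma(\nu_i+k+1)}\,(z\overline{w})^k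 .$$ Here $(a)_k=\Gamma(a+k)/\Gamma(a)=a(a+1)\cdots(a+k-1)$ is the Pochhammer symbol and $${}_pF_q(a_1,\ldots,a_p;b_1,\ldots,b_q;x)=\sum_{k\ge0}\frac{(a_1)_k\cdots(a_p)_k}{(b_1)_k\cdots(b_q)_k}\frac{x^k}{k!},$$ which is a finite sum in the present case. *)

theory Defs
  imports "HOL-Analysis.Analysis"
begin

definition factor_weight :: "nat \<Rightarrow> nat \<Rightarrow> complex \<Rightarrow> real" where
  "factor_weight m N x = norm x ^ (2 * m) / (1 + (norm x)\<^sup>2) ^ (m + N + 1)"

text \<open>
  The Dirac delta is resolved in the variable of index 1: for fixed nonzero
  \<open>y = x\<^sub>2 \<cdots> x\<^sub>n\<close>, integrating \<open>\<delta> (z - x\<^sub>1 y)\<close> against \<open>d\<^sup>2x\<^sub>1\<close> evaluates the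
  integrand at \<open>x\<^sub>1 = z / y\<close> with the real Jacobian \<open>1 / |y|\<^sup>2\<close>.  The lemma
  \<open>weight_delta\<close> below shows that this is the integral against the delta function:
  for every measurable \<open>g \<ge> 0\<close>, integrating \<open>g\<close> against \<open>weight\<close> is integrating
  \<open>g (x\<^sub>1 \<cdots> x\<^sub>n)\<close> against the product of the \<open>n\<close> factors.  Where the integral diverges
  (this happens only at \<open>z = 0\<close>, when \<open>\<nu> 1 = 0\<close> and another \<open>\<nu> j\<close> vanishes) its value is 0.
\<close>
definition weight :: "nat \<Rightarrow> nat \<Rightarrow> (nat \<Rightarrow> nat) \<Rightarrow> complex \<Rightarrow> real" where
  "weight n N \<nu> z =
     (LINT x | (\<Pi>\<^sub>M j\<in>{2..n}. lborel).
        factor_weight (\<nu> 1) N (z / (\<Prod>j=2..n. x j)) / (norm (\<Prod>j=2..n. x j))\<^sup>2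
          * (\<Prod>j=2..n. factor_weight (\<nu> j) N (x j)))"

definition orthonormal_polys :: "(complex \<Rightarrow> real) \<Rightarrow> nat \<Rightarrow> (nat \<Rightarrow> complex poly) \<Rightarrow> bool" where
  "orthonormal_polys w N p \<longleftrightarrow>
     (\<forall>k<N. degree (p k) = k) \<and>
     (\<forall>k<N. \<forall>l<N.
        integrable lborel (\<lambda>z. poly (p k) z * cnj (poly (p l) z) * complex_of_real (w z)) \<and>
        (LINT z | lborel. poly (p k) z * cnj (poly (p l) z) * complex_of_real (w z)) =
          (if k = l then 1 else 0))"

definition correlation_kernel ::
    "nat \<Rightarrow> nat \<Rightarrow> (nat \<Rightarrow> nat) \<Rightarrow> (nat \<Rightarrow> complex poly) \<Rightarrow> complex \<Rightarrow> complex \<Rightarrow> complex" where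
  "correlation_kernel n N \<nu> p z w =
     complex_of_real (sqrt (weight n N \<nu> z * weight n N \<nu> w)) *
       (\<Sum>k<N. poly (p k) z * cnj (poly (p k) w))"

definition hypergeometric :: "complex list \<Rightarrow> complex list \<Rightarrow> complex \<Rightarrow> complex" where
  "hypergeometric as bs x = eval_fps (fps_hypergeo as bs 1) x"

lemma hypergeometric_altdef:
  "hypergeometric as bs x =
     (\<Sum>k. (\<Prod>a\<leftarrow>as. pochhammer a k) / (\<Prod>b\<leftarrow>bs. pochhammer b k) * x ^ k / fact k)"
proof -
  have *: "foldr (\<lambda>a r. r * pochhammer a k) cs c = c * (\<Prod>a\<leftarrow>cs. pochhammer a k)"
    for cs and c :: complex and k
    by (induction cs) (auto simp: mult_ac)
  show ?thesis
    unfolding hypergeometric_def eval_fps_def fps_hypergeo_nth_alt *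
    by (simp add: field_simps)
qed

lemma weight_1: "weight 1 N \<nu> z = factor_weight (\<nu> 1) N z"
proof -
  have "{2..1::nat} = {}" by simp
  then show ?thesis
    by (simp add: weight_def PiM_empty lebesgue_integral_count_space_finite)
qed

lemma nn_integral_complex:
  fixes f :: "complex \<Rightarrow> ennreal"
  assumes [measurable]: "f \<in> borel_measurable borel"
  shows "(\<integral>\<^sup>+x. f x \<partial>lborel) = (\<integral>\<^sup>+u. \<integral>\<^sup>+v. f (Complex u v) \<partial>lborel \<partial>lborel)"
proof -
  have [measurable]: "(\<lambda>p. Complex (fst p) (snd p)) \<in> borel_measurable (borel \<Otimes>\<^sub>M borel)"
    by (subst borel_measurable_complex_iff) simp
  have "lborel = distr (lborel \<Otimes>\<^sub>M lborel) borel (\<lambda>p. Complex (fst p) (snd p))"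
  proof (rule lborel_eqI)
    fix l u :: complex assume le: "\<And>b. b \<in> Basis \<Longrightarrow> l \<bullet> b \<le> u \<bullet> b"
    have le': "Re l \<le> Re u" "Im l \<le> Im u"
      using le[of 1] le[of \<i>] by auto
    have "(\<lambda>p. Complex (fst p) (snd p)) -` box l u \<inter> space (lborel \<Otimes>\<^sub>M lborel) =
            {Re l<..<Re u} \<times> {Im l<..<Im u}"
      by (auto simp: in_box_complex_iff space_pair_measure)
    then show "emeasure (distr (lborel \<Otimes>\<^sub>M lborel) borel (\<lambda>p. Complex (fst p) (snd p))) (box l u)
        = (\<Prod>b\<in>Basis. (u - l) \<bullet> b)"
      using le' by (simp add: emeasure_distr lborel.emeasure_pair_measure_Times Basis_complex_def
          ennreal_mult)
  qed simp
  then have "(\<integral>\<^sup>+x. f x \<partial>lborel) =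
      (\<integral>\<^sup>+x. f x \<partial>distr (lborel \<Otimes>\<^sub>M lborel) borel (\<lambda>p. Complex (fst p) (snd p)))"
    by (rule arg_cong)
  also have "\<dots> = (\<integral>\<^sup>+p. f (Complex (fst p) (snd p)) \<partial>(lborel \<Otimes>\<^sub>M lborel))"
    by (subst nn_integral_distr) auto
  also have "\<dots> = (\<integral>\<^sup>+u. \<integral>\<^sup>+v. f (Complex u v) \<partial>lborel \<partial>lborel)"
    by (subst lborel.nn_integral_fst[symmetric]) (auto simp: measurable_lborel1)
  finally show ?thesis .
qed

lemma measurable_Complex [measurable (raw)]:
  assumes "f \<in> borel_measurable M" "g \<in> borel_measurable M"
  shows "(\<lambda>x. Complex (f x) (g x)) \<in> borel_measurable M"
  by (subst borel_measurable_complex_iff) (simp add: assms)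

lemma nn_integral_complex_mult:
  fixes f :: "complex \<Rightarrow> ennreal"
  assumes [measurable]: "f \<in> borel_measurable borel" and "y \<noteq> 0"
  shows "(\<integral>\<^sup>+x. f x \<partial>lborel) = ennreal ((norm y)\<^sup>2) * (\<integral>\<^sup>+x. f (y * x) \<partial>lborel)"
proof -
  define a b where "a = Re y" and "b = Im y"
  have y: "y = Complex a b" by (simp add: a_def b_def)
  have ny: "(norm y)\<^sup>2 = a\<^sup>2 + b\<^sup>2" by (simp add: y cmod_power2)
  have rhs: "(\<integral>\<^sup>+x. f (y * x) \<partial>lborel) =
      (\<integral>\<^sup>+u. \<integral>\<^sup>+v. f (Complex (a * u - b * v) (a * v + b * u)) \<partial>lborel \<partial>lborel)"
  proof (subst nn_integral_complex)
    have "y * Complex u v = Complex (a * u - b * v) (a * v + b * u)" for u v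
      by (simp add: y complex_eq_iff)
    then show "(\<integral>\<^sup>+u. \<integral>\<^sup>+v. f (y * Complex u v) \<partial>lborel \<partial>lborel) =
        (\<integral>\<^sup>+u. \<integral>\<^sup>+v. f (Complex (a * u - b * v) (a * v + b * u)) \<partial>lborel \<partial>lborel)"
      by simp
  qed simp
  show ?thesis
  proof (cases "a = 0")
    case True
    with \<open>y \<noteq> 0\<close> have b: "b \<noteq> 0" by (auto simp: y complex_eq_iff)
    have "(\<integral>\<^sup>+x. f x \<partial>lborel) = (\<integral>\<^sup>+v. \<integral>\<^sup>+u. f (Complex v u) \<partial>lborel \<partial>lborel)"
      by (rule nn_integral_complex) simp
    also have "\<dots> = \<bar>- b\<bar> * (\<integral>\<^sup>+v. \<integral>\<^sup>+u. f (Complex (0 + (- b) * v) u) \<partial>lborel \<partial>lborel)"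
      using b by (intro nn_integral_real_affine) auto
    also have "(\<integral>\<^sup>+v. \<integral>\<^sup>+u. f (Complex (0 + (- b) * v) u) \<partial>lborel \<partial>lborel) =
        (\<integral>\<^sup>+v. \<bar>b\<bar> * (\<integral>\<^sup>+u. f (Complex (0 + (- b) * v) (0 + b * u)) \<partial>lborel) \<partial>lborel)"
      using b by (intro nn_integral_cong nn_integral_real_affine) auto
    also have "\<dots> = \<bar>b\<bar> * (\<integral>\<^sup>+v. \<integral>\<^sup>+u. f (Complex (0 + (- b) * v) (0 + b * u)) \<partial>lborel \<partial>lborel)"
      by (subst nn_integral_cmult) auto
    also have "(\<integral>\<^sup>+v. \<integral>\<^sup>+u. f (Complex (0 + (- b) * v) (0 + b * u)) \<partial>lborel \<partial>lborel) =
        (\<integral>\<^sup>+u. \<integral>\<^sup>+v. f (Complex (0 + (- b) * v) (0 + b * u)) \<partial>lborel \<partial>lborel)"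
      by (rule lborel_pair.Fubini') auto
    finally show ?thesis
      unfolding rhs ny using True
      by (simp add: mult.assoc[symmetric] ennreal_mult[symmetric] power2_eq_square)
  next
    case False
    define c where "c = (a\<^sup>2 + b\<^sup>2) / a"
    have c0: "c \<noteq> 0" and c: "\<bar>a\<bar> * \<bar>c\<bar> = a\<^sup>2 + b\<^sup>2"
      using False by (auto simp: c_def abs_mult[symmetric] add_nonneg_eq_0_iff)
    have ident: "a * v + b * (b * v / a + (1/a) * s) = b * s / a + c * v" for s v
      using False by (simp add: c_def field_simps power2_eq_square)
    have "(\<integral>\<^sup>+u. \<integral>\<^sup>+v. f (Complex (a * u - b * v) (a * v + b * u)) \<partial>lborel \<partial>lborel) =
        (\<integral>\<^sup>+v. \<integral>\<^sup>+u. f (Complex (a * u - b * v) (a * v + b * u)) \<partial>lborel \<partial>lborel)"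
      by (rule lborel_pair.Fubini') auto
    also have "\<dots> = (\<integral>\<^sup>+v. \<bar>1/a\<bar> * (\<integral>\<^sup>+s. f (Complex (a * (b * v / a + (1/a) * s) - b * v)
        (a * v + b * (b * v / a + (1/a) * s))) \<partial>lborel) \<partial>lborel)"
      using False by (intro nn_integral_cong nn_integral_real_affine) auto
    also have "\<dots> = (\<integral>\<^sup>+v. \<bar>1/a\<bar> * (\<integral>\<^sup>+s. f (Complex s (b * s / a + c * v)) \<partial>lborel) \<partial>lborel)"
      unfolding ident using False by (simp add: distrib_left)
    also have "\<dots> = \<bar>1/a\<bar> * (\<integral>\<^sup>+v. \<integral>\<^sup>+s. f (Complex s (b * s / a + c * v)) \<partial>lborel \<partial>lborel)"
      by (rule nn_integral_cmult) auto
    also have "(\<integral>\<^sup>+v. \<integral>\<^sup>+s. f (Complex s (b * s / a + c * v)) \<partial>lborel \<partial>lborel) =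
        (\<integral>\<^sup>+s. \<integral>\<^sup>+v. f (Complex s (b * s / a + c * v)) \<partial>lborel \<partial>lborel)"
      by (rule lborel_pair.Fubini') auto
    finally have 1: "(\<integral>\<^sup>+x. f (y * x) \<partial>lborel) =
        \<bar>1/a\<bar> * (\<integral>\<^sup>+s. \<integral>\<^sup>+v. f (Complex s (b * s / a + c * v)) \<partial>lborel \<partial>lborel)"
      unfolding rhs .
    have "(\<integral>\<^sup>+x. f x \<partial>lborel) = (\<integral>\<^sup>+s. \<integral>\<^sup>+v. f (Complex s v) \<partial>lborel \<partial>lborel)"
      by (rule nn_integral_complex) simp
    also have "\<dots> = (\<integral>\<^sup>+s. \<bar>c\<bar> * (\<integral>\<^sup>+v. f (Complex s (b * s / a + c * v)) \<partial>lborel) \<partial>lborel)"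
      using c0 by (intro nn_integral_cong nn_integral_real_affine) auto
    also have "\<dots> = \<bar>c\<bar> * (\<integral>\<^sup>+s. \<integral>\<^sup>+v. f (Complex s (b * s / a + c * v)) \<partial>lborel \<partial>lborel)"
      by (rule nn_integral_cmult) auto
    also have "ennreal \<bar>c\<bar> = ennreal (a\<^sup>2 + b\<^sup>2) * ennreal \<bar>1/a\<bar>"
      using False by (subst ennreal_mult[symmetric]) (auto simp: c[symmetric])
    finally show ?thesis
      unfolding 1 ny by (simp add: mult.assoc)
  qed
qed

lemma factor_weight_nonneg [simp]: "0 \<le> factor_weight m N x"
  by (simp add: factor_weight_def)

lemma borel_measurable_factor_weight [measurable]: "factor_weight m N \<in> borel_measurable borel"
  unfolding factor_weight_def by measurable

lemma factor_weight_le_inverse: "(norm x)\<^sup>2 * factor_weight m N x \<le> 1"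
proof -
  have "(norm x)\<^sup>2 * norm x ^ (2 * m) = ((norm x)\<^sup>2) ^ (m + 1)"
    by (simp add: power_mult[symmetric])
  also have "\<dots> \<le> (1 + (norm x)\<^sup>2) ^ (m + 1)"
    by (rule power_mono) auto
  also have "\<dots> \<le> (1 + (norm x)\<^sup>2) ^ (m + N + 1)"
    by (rule power_increasing) auto
  finally have "(norm x)\<^sup>2 * norm x ^ (2 * m) \<le> (1 + (norm x)\<^sup>2) ^ (m + N + 1)" .
  moreover have "0 < (1 + (norm x)\<^sup>2) ^ (m + N + 1)"
    by (intro zero_less_power add_pos_nonneg) auto
  ultimately show ?thesis
    unfolding factor_weight_def by (simp only: times_divide_eq_right divide_le_eq_1_pos)
qed

lemma factor_weight_le:
  assumes "1 \<le> N"
  shows "factor_weight m N x \<le> 1 / (1 + (norm x)\<^sup>2)\<^sup>2"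
proof -
  have "norm x ^ (2 * m) * (1 + (norm x)\<^sup>2)\<^sup>2 = ((norm x)\<^sup>2) ^ m * (1 + (norm x)\<^sup>2)\<^sup>2"
    by (simp add: power_mult)
  also have "\<dots> \<le> (1 + (norm x)\<^sup>2) ^ m * (1 + (norm x)\<^sup>2)\<^sup>2"
    by (intro mult_right_mono power_mono) auto
  also have "\<dots> = (1 + (norm x)\<^sup>2) ^ (m + 2)"
    by (simp add: power_add power2_eq_square)
  also have "\<dots> \<le> (1 + (norm x)\<^sup>2) ^ (m + N + 1)"
    using assms by (intro power_increasing) auto
  finally have "norm x ^ (2 * m) * (1 + (norm x)\<^sup>2)\<^sup>2 \<le> 1 * (1 + (norm x)\<^sup>2) ^ (m + N + 1)"
    by simp
  moreover have "0 < (1 + (norm x)\<^sup>2) ^ k" for k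
    by (intro zero_less_power add_pos_nonneg) auto
  ultimately show ?thesis
    unfolding factor_weight_def by (simp only: pos_divide_le_eq pos_le_divide_eq
        times_divide_eq_left)
qed

lemma nn_integral_inverse_1_plus_square_finite:
  "(\<integral>\<^sup>+(x::real). ennreal (1 / (1 + x\<^sup>2)) \<partial>lborel) < \<infinity>"
proof -
  have pos: "1 + x\<^sup>2 > 0" for x :: real by (simp add: add_pos_nonneg)
  have h: "(\<integral>\<^sup>+(x::real). ennreal (1 / (1 + x\<^sup>2)) * indicator {0..} x \<partial>lborel) = ennreal (pi/2 - arctan 0)"
    by (rule nn_integral_FTC_atLeast)
       (use pos in \<open>auto intro!: derivative_eq_intros tendsto_arctan_at_top simp: field_simps less_imp_le\<close>)
  have h': "(\<integral>\<^sup>+(x::real). ennreal (1 / (1 + x\<^sup>2)) * indicator {..0} x \<partial>lborel) =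
      (\<integral>\<^sup>+(x::real). ennreal (1 / (1 + x\<^sup>2)) * indicator {0..} x \<partial>lborel)"
    by (subst nn_integral_real_affine[where c = "-1" and t = 0])
       (auto intro!: nn_integral_cong simp: indicator_def)
  have "(\<integral>\<^sup>+(x::real). ennreal (1 / (1 + x\<^sup>2)) \<partial>lborel) \<le>
      (\<integral>\<^sup>+(x::real). ennreal (1 / (1 + x\<^sup>2)) * indicator {0..} x +
        ennreal (1 / (1 + x\<^sup>2)) * indicator {..0} x \<partial>lborel)"
    by (intro nn_integral_mono) (auto simp: indicator_def)
  also have "\<dots> = ennreal (pi/2 - arctan 0) + ennreal (pi/2 - arctan 0)"
    using h h' by (subst nn_integral_add) auto
  finally show ?thesis
    by (auto simp: ennreal_plus[symmetric] simp del: ennreal_plus elim: le_less_trans)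
qed

lemma nn_integral_factor_weight_finite:
  assumes "1 \<le> N"
  shows "(\<integral>\<^sup>+x. ennreal (factor_weight m N x) \<partial>lborel) < \<infinity>"
proof -
  have pos: "1 + x\<^sup>2 > 0" for x :: real by (simp add: add_pos_nonneg)
  have "(\<integral>\<^sup>+x. ennreal (factor_weight m N x) \<partial>lborel) =
      (\<integral>\<^sup>+u. \<integral>\<^sup>+v. ennreal (factor_weight m N (Complex u v)) \<partial>lborel \<partial>lborel)"
    by (rule nn_integral_complex) simp
  also have "\<dots> \<le> (\<integral>\<^sup>+u. \<integral>\<^sup>+v. ennreal (1 / (1 + u\<^sup>2)) * ennreal (1 / (1 + v\<^sup>2)) \<partial>lborel \<partial>lborel)"
  proof (intro nn_integral_mono)
    fix u v :: real
    have "factor_weight m N (Complex u v) \<le> 1 / (1 + (u\<^sup>2 + v\<^sup>2))\<^sup>2"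
      using factor_weight_le[OF assms, of m "Complex u v"] by (simp add: cmod_power2)
    also have "\<dots> \<le> 1 / ((1 + u\<^sup>2) * (1 + v\<^sup>2))"
    proof (rule divide_left_mono)
      show "(1 + u\<^sup>2) * (1 + v\<^sup>2) \<le> (1 + (u\<^sup>2 + v\<^sup>2))\<^sup>2"
        unfolding power2_eq_square[of "1 + (u\<^sup>2 + v\<^sup>2)"]
        by (intro mult_mono) auto
      show "0 < (1 + (u\<^sup>2 + v\<^sup>2))\<^sup>2 * ((1 + u\<^sup>2) * (1 + v\<^sup>2))"
        using pos[of u] pos[of v] by (auto intro!: mult_pos_pos zero_less_power add_pos_nonneg)
    qed auto
    also have "\<dots> = 1 / (1 + u\<^sup>2) * (1 / (1 + v\<^sup>2))" by simp
    finally show "ennreal (factor_weight m N (Complex u v)) \<le>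
        ennreal (1 / (1 + u\<^sup>2)) * ennreal (1 / (1 + v\<^sup>2))"
      by (subst ennreal_mult[symmetric]) (auto intro!: ennreal_leI)
  qed
  also have "\<dots> = (\<integral>\<^sup>+(x::real). ennreal (1 / (1 + x\<^sup>2)) \<partial>lborel) * (\<integral>\<^sup>+(x::real). ennreal (1 / (1 + x\<^sup>2)) \<partial>lborel)"
    by (simp add: nn_integral_cmult nn_integral_multc)
  also have "\<dots> < \<infinity>"
    using nn_integral_inverse_1_plus_square_finite by (simp add: ennreal_mult_less_top)
  finally show ?thesis .
qed

lemma AE_PiM_lborel_nonzero:
  assumes "finite I" "i \<in> I"
  shows "AE x in (\<Pi>\<^sub>M j\<in>I. lborel). x i \<noteq> (0::complex)"
proof -
  interpret product_sigma_finite "\<lambda>_::'a. lborel :: complex measure" by standard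
  let ?A = "\<lambda>j. if j = i then {0::complex} else UNIV"
  have "emeasure (\<Pi>\<^sub>M j\<in>I. lborel) (Pi\<^sub>E I ?A) = (\<Prod>j\<in>I. emeasure lborel (?A j))"
    by (rule emeasure_PiM) (use assms in auto)
  also have "\<dots> = 0"
    using assms by (intro prod_zero) auto
  finally have 0: "emeasure (\<Pi>\<^sub>M j\<in>I. lborel) (Pi\<^sub>E I ?A) = 0" .
  have "Pi\<^sub>E I ?A \<in> sets (\<Pi>\<^sub>M j\<in>I. lborel)"
    using assms by (intro sets_PiM_I_finite) auto
  with 0 have "Pi\<^sub>E I ?A \<in> null_sets (\<Pi>\<^sub>M j\<in>I. lborel)"
    by auto
  then show ?thesis
    by (rule AE_I') (use assms in \<open>auto simp: space_PiM PiE_def Pi_def\<close>)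
qed

lemma weight_delta:
  fixes g :: "complex \<Rightarrow> ennreal"
  assumes n: "1 \<le> n" and N: "1 \<le> N" and g [measurable]: "g \<in> borel_measurable borel"
  shows "(\<integral>\<^sup>+z. g z * ennreal (weight n N \<nu> z) \<partial>lborel) =
    (\<integral>\<^sup>+x. g (\<Prod>j=1..n. x j) * ennreal (\<Prod>j=1..n. factor_weight (\<nu> j) N (x j))
       \<partial>(\<Pi>\<^sub>M j\<in>{1..n}. lborel))"
proof -
  interpret product_sigma_finite "\<lambda>_::nat. lborel :: complex measure" by standard
  let ?M = "\<Pi>\<^sub>M j\<in>{2..n}. (lborel :: complex measure)"
  interpret M: finite_product_sigma_finite "\<lambda>_::nat. lborel :: complex measure" "{2..n}"
    by standard auto
  interpret P: pair_sigma_finite ?M "lborel :: complex measure"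
    by standard
  define Y :: "(nat \<Rightarrow> complex) \<Rightarrow> complex" where "Y = (\<lambda>x. \<Prod>j=2..n. x j)"
  define F where "F = (\<lambda>x::nat \<Rightarrow> complex. \<Prod>j=2..n. factor_weight (\<nu> j) N (x j))"
  define h where "h = factor_weight (\<nu> 1) N"
  have [measurable]: "Y \<in> borel_measurable ?M" "F \<in> borel_measurable ?M"
    unfolding Y_def F_def by measurable
  have [measurable]: "h \<in> borel_measurable borel" unfolding h_def by simp
  have F0: "F x \<ge> 0" and h0: "h z \<ge> 0" for x z
    by (auto simp: F_def h_def intro: prod_nonneg)
  have Ynz: "AE x in ?M. Y x \<noteq> 0"
  proof -
    have "AE x in ?M. \<forall>j\<in>{2..n}. x j \<noteq> 0"
      by (intro AE_finite_allI AE_PiM_lborel_nonzero) auto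
    then show ?thesis by eventually_elim (simp add: Y_def)
  qed
  have Ffin: "(\<integral>\<^sup>+x. ennreal (F x) \<partial>?M) < \<infinity>"
  proof -
    have "(\<integral>\<^sup>+x. ennreal (F x) \<partial>?M) = (\<integral>\<^sup>+x. (\<Prod>j=2..n. ennreal (factor_weight (\<nu> j) N (x j))) \<partial>?M)"
      by (simp add: F_def prod_ennreal)
    also have "\<dots> = (\<Prod>j=2..n. \<integral>\<^sup>+x. ennreal (factor_weight (\<nu> j) N x) \<partial>lborel)"
      by (rule product_nn_integral_prod) auto
    also have "\<dots> < \<infinity>"
      using nn_integral_factor_weight_finite[OF N]
      by (auto simp: less_top[symmetric] ennreal_prod_eq_top)
    finally show ?thesis .
  qed
  have w: "ennreal (weight n N \<nu> z) = (\<integral>\<^sup>+x. ennreal (h (z / Y x) / (norm (Y x))\<^sup>2 * F x) \<partial>?M)"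
    if z: "z \<noteq> 0" for z
  proof -
    have "integrable ?M (\<lambda>x. h (z / Y x) / (norm (Y x))\<^sup>2 * F x)"
    proof (rule integrableI_bounded)
      have "(\<integral>\<^sup>+x. ennreal (norm (h (z / Y x) / (norm (Y x))\<^sup>2 * F x)) \<partial>?M) \<le>
          (\<integral>\<^sup>+x. ennreal (1 / (norm z)\<^sup>2) * ennreal (F x) \<partial>?M)"
      proof (intro nn_integral_mono)
        fix x
        have "h (z / Y x) / (norm (Y x))\<^sup>2 \<le> 1 / (norm z)\<^sup>2"
        proof (cases "Y x = 0")
          case False
          have "(norm (z / Y x))\<^sup>2 * h (z / Y x) \<le> 1"
            unfolding h_def by (rule factor_weight_le_inverse)
          then show ?thesis
            using False z by (simp add: norm_divide field_simps)
        qed simp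
        then have "h (z / Y x) / (norm (Y x))\<^sup>2 * F x \<le> 1 / (norm z)\<^sup>2 * F x"
          using F0 by (rule mult_right_mono)
        then show "ennreal (norm (h (z / Y x) / (norm (Y x))\<^sup>2 * F x)) \<le>
            ennreal (1 / (norm z)\<^sup>2) * ennreal (F x)"
          using F0[of x] h0[of "z / Y x"]
          by (subst ennreal_mult[symmetric]) (auto intro!: ennreal_leI simp: abs_mult)
      qed
      also have "\<dots> < \<infinity>"
        using Ffin by (simp add: nn_integral_cmult ennreal_mult_less_top)
      finally show "(\<integral>\<^sup>+x. ennreal (norm (h (z / Y x) / (norm (Y x))\<^sup>2 * F x)) \<partial>?M) < \<infinity>" .
    qed measurable
    then show ?thesis
      unfolding weight_def Y_def[symmetric] F_def[symmetric] h_def[symmetric]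
      using F0 h0 by (subst nn_integral_eq_integral) (auto simp: Y_def F_def h_def)
  qed
  have split: "{1..n} = insert 1 {2..n}"
    using n by auto
  have "(\<integral>\<^sup>+x. g (\<Prod>j=1..n. x j) * ennreal (\<Prod>j=1..n. factor_weight (\<nu> j) N (x j))
       \<partial>(\<Pi>\<^sub>M j\<in>{1..n}. lborel)) =
     (\<integral>\<^sup>+x. \<integral>\<^sup>+t. g (t * Y x) * ennreal (h t * F x) \<partial>lborel \<partial>?M)"
  proof -
    have "(\<Prod>j=2..n. (x(1 := t)) j) = Y x" "(\<Prod>j=2..n. factor_weight (\<nu> j) N ((x(1 := t)) j)) = F x"
      for x and t :: complex
      by (auto simp: Y_def F_def intro!: prod.cong)
    moreover have "(\<integral>\<^sup>+x. g (\<Prod>j\<in>insert 1 {2..n}. x j) *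
          ennreal (\<Prod>j\<in>insert 1 {2..n}. factor_weight (\<nu> j) N (x j))
          \<partial>(\<Pi>\<^sub>M j\<in>insert 1 {2..n}. lborel)) =
        (\<integral>\<^sup>+x. \<integral>\<^sup>+t. g (\<Prod>j\<in>insert 1 {2..n}. (x(1 := t)) j) *
          ennreal (\<Prod>j\<in>insert 1 {2..n}. factor_weight (\<nu> j) N ((x(1 := t)) j)) \<partial>lborel \<partial>?M)"
      by (rule product_nn_integral_insert) (simp, simp, measurable)
    ultimately show ?thesis
      unfolding split by (simp add: h_def)
  qed
  also have "\<dots> = (\<integral>\<^sup>+x. \<integral>\<^sup>+z. g z * ennreal (h (z / Y x) / (norm (Y x))\<^sup>2 * F x) \<partial>lborel \<partial>?M)"
  proof (rule nn_integral_cong_AE, use Ynz in eventually_elim)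
    fix x assume nz: "Y x \<noteq> 0"
    have "(\<integral>\<^sup>+z. g z * ennreal (h (z / Y x) / (norm (Y x))\<^sup>2 * F x) \<partial>lborel) =
        ennreal ((norm (Y x))\<^sup>2) *
          (\<integral>\<^sup>+t. g (Y x * t) * ennreal (h (Y x * t / Y x) / (norm (Y x))\<^sup>2 * F x) \<partial>lborel)"
      using nz by (intro nn_integral_complex_mult) auto
    also have "\<dots> = (\<integral>\<^sup>+t. ennreal ((norm (Y x))\<^sup>2) *
          (g (Y x * t) * ennreal (h (Y x * t / Y x) / (norm (Y x))\<^sup>2 * F x)) \<partial>lborel)"
      by (rule nn_integral_cmult[symmetric]) auto
    also have "\<dots> = (\<integral>\<^sup>+t. g (t * Y x) * ennreal (h t * F x) \<partial>lborel)"
    proof (rule nn_integral_cong)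
      fix t
      have "ennreal ((norm (Y x))\<^sup>2) * ennreal (h t / (norm (Y x))\<^sup>2 * F x) = ennreal (h t * F x)"
        using nz F0[of x] h0[of t] by (subst ennreal_mult[symmetric]) auto
      then show "ennreal ((norm (Y x))\<^sup>2) *
          (g (Y x * t) * ennreal (h (Y x * t / Y x) / (norm (Y x))\<^sup>2 * F x)) =
          g (t * Y x) * ennreal (h t * F x)"
        using nz by (simp add: mult.left_commute mult.commute[of t])
    qed
    finally show "(\<integral>\<^sup>+t. g (t * Y x) * ennreal (h t * F x) \<partial>lborel) =
        (\<integral>\<^sup>+z. g z * ennreal (h (z / Y x) / (norm (Y x))\<^sup>2 * F x) \<partial>lborel)" ..
  qed
  also have "\<dots> = (\<integral>\<^sup>+z. \<integral>\<^sup>+x. g z * ennreal (h (z / Y x) / (norm (Y x))\<^sup>2 * F x) \<partial>?M \<partial>lborel)"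
    by (rule P.Fubini'[symmetric]) measurable
  also have "\<dots> = (\<integral>\<^sup>+z. g z * ennreal (weight n N \<nu> z) \<partial>lborel)"
  proof (rule nn_integral_cong_AE, use AE_lborel_singleton[of 0] in eventually_elim)
    fix z :: complex assume "z \<noteq> 0"
    then show "(\<integral>\<^sup>+x. g z * ennreal (h (z / Y x) / (norm (Y x))\<^sup>2 * F x) \<partial>?M) =
        g z * ennreal (weight n N \<nu> z)"
      by (simp add: w nn_integral_cmult)
  qed
  finally show ?thesis ..
qed

end

theory Submission
  imports Defs
begin

text \<open>
  The weight is invariant under rotations, so monomials of different degree are orthogonal, and
  orthonormality together with \<open>degree (p k) = k\<close> forces, inductively, \<open>p k = a\<^sub>k z\<^sup>k\<close> with
  \<open>|a\<^sub>k|\<^sup>2 h\<^sub>k = 1\<close>, where \<open>h\<^sub>k\<close> is the integral of \<open>|z|\<^bsup>2k\<^esup>\<close> against the weight.  By the delta-function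
  formula \<open>h\<^sub>k\<close> is a product of one-variable moments, each \<open>\<pi>\<close> times a Beta integral after the
  substitution \<open>r = |x|\<^sup>2\<close>.  What remains is to rewrite \<open>1 / h\<^sub>k\<close> in Pochhammer symbols, where \<open>\<nu>\<^sub>1 = 0\<close>
  supplies the \<open>k!\<close> of the hypergeometric series.
\<close>

section \<open>One-variable moments as Beta integrals\<close>

text \<open>This is the Beta integral B(m+1, q+1) in its half-line form. The induction on
  \<open>q\<close> keeps \<open>m\<close> arbitrary because the reduction calls the hypothesis at
  both \<open>m\<close> and \<open>Suc m\<close>.\<close>

lemma has_bochner_integral_radial:
  fixes m q :: nat
  shows "has_bochner_integral lborel
    (\<lambda>r::real. indicator {0..} r * (r ^ m / (1 + r) ^ (m + q + 2))) (fact m * fact q / fact (m + q + 1))"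
proof (induction q arbitrary: m)
  case 0
  show ?case
  proof (rule has_bochner_integral_nn_integral)
    have "(\<integral>\<^sup>+r. ennreal (r ^ m / (1 + r) ^ (m + 2)) * indicator {0..} r \<partial>lborel) =
        ennreal (1 / (m + 1) - (0 / (1 + 0)) ^ (m + 1) / (m + 1))"
    proof (rule nn_integral_FTC_atLeast)
      fix r :: real assume r: "0 \<le> r"
      \<comment> \<open>Since r/(1+r) has derivative 1/(1+r)^2, the integrand for
        \<open>q = 0\<close> is the derivative of a power of r/(1+r). The boundary values are 0 at 0
        and 1/(m+1) at infinity.\<close>
      have "((\<lambda>r. r / (1 + r)) has_real_derivative 1 / (1 + r)\<^sup>2) (at r)"
        using r by (auto intro!: derivative_eq_intros simp: field_simps power2_eq_square)
      from DERIV_cdivide[OF DERIV_power[OF this, of "m + 1"], of "real (m + 1)"]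
      show "((\<lambda>r. (r / (1 + r)) ^ (m + 1) / real (m + 1)) has_real_derivative
          r ^ m / (1 + r) ^ (m + 2)) (at r)"
        by (simp add: power_divide power_add power2_eq_square mult_ac del: of_nat_Suc)
      show "0 \<le> r ^ m / (1 + r) ^ (m + 2)" using r by simp
    next
      have "((\<lambda>r::real. 1 - inverse (1 + r)) \<longlongrightarrow> 1 - 0) at_top"
        by (intro tendsto_intros tendsto_inverse_0_at_top filterlim_tendsto_add_at_top[OF tendsto_const])
           (rule filterlim_ident)
      moreover have "eventually (\<lambda>r::real. 1 - inverse (1 + r) = r / (1 + r)) at_top"
        using eventually_gt_at_top[of 0] by eventually_elim (simp add: field_simps)
      ultimately have "((\<lambda>r::real. r / (1 + r)) \<longlongrightarrow> 1) at_top"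
        by (simp add: tendsto_cong)
      from tendsto_divide[OF tendsto_power[OF this, of "m + 1"] tendsto_const[of "real (m + 1)"]]
      show "((\<lambda>r. (r / (1 + r)) ^ (m + 1) / real (m + 1)) \<longlongrightarrow> 1 / (m + 1)) at_top"
        by simp
    qed auto
    then show "(\<integral>\<^sup>+r. ennreal (indicator {0..} r * (r ^ m / (1 + r) ^ (m + 0 + 2))) \<partial>lborel) =
        ennreal (fact m * fact 0 / fact (m + 0 + 1))"
      by (simp add: ennreal_mult' ennreal_indicator mult.commute del: times_divide_eq_left times_divide_eq_right)
  qed (auto intro!: AE_I2 simp: indicator_def)
next
  case (Suc q)
  \<comment> \<open>Writing \<open>1 = (1 + r) - r\<close> in the numerator lowers \<open>q\<close> without integrating by parts.\<close>
  have eq: "indicator {0..} r * (r ^ m / (1 + r) ^ (m + Suc q + 2)) =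
      indicator {0..} r * (r ^ m / (1 + r) ^ (m + q + 2)) -
      indicator {0..} r * (r ^ Suc m / (1 + r) ^ (Suc m + q + 2))" for r :: real
  proof (cases "0 \<le> r")
    case True
    then have "r ^ m / (1 + r) ^ (m + q + 2) = (1 + r) * r ^ m / ((1 + r) * (1 + r) ^ (m + q + 2))"
      by simp
    then show ?thesis
      using True by (simp add: diff_divide_distrib[symmetric] distrib_right)
  qed simp
  \<comment> \<open>Over the common denominator this is (m+q+2) - (m+1) = q+1.\<close>
  have val: "fact m * fact (Suc q) / fact (m + Suc q + 1) =
      fact m * fact q / fact (m + q + 1) - fact (Suc m) * fact q / (fact (Suc m + q + 1) :: real)"
  proof -
    define D :: real where "D = fact (m + q + 1)"
    have D: "fact (m + Suc q + 1) = (real m + real q + 2) * D" "fact (Suc m + q + 1) = (real m + real q + 2) * D"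
      "D \<noteq> 0" "real m + real q + 2 \<noteq> 0"
      unfolding D_def by (simp_all add: algebra_simps del: fact_Suc) (simp_all add: algebra_simps)
    have "fact m * fact q / D = (real m + real q + 2) * (fact m * fact q) / ((real m + real q + 2) * D)"
      using D by simp
    then show ?thesis
      unfolding D(1,2) D_def[symmetric] by (simp add: diff_divide_distrib[symmetric] algebra_simps)
  qed
  show ?case
    unfolding eq val by (intro has_bochner_integral_diff Suc.IH)
qed

text \<open>The disc |x|^2 \<le> t has area pi t, so the two measures agree on half-lines, which
  form an intersection-stable generator of the Borel sets. This replaces polar coordinates for
  radial integrands.\<close>

lemma distr_complex_norm_square:
  "distr lborel borel (\<lambda>x::complex. (norm x)\<^sup>2) = density lborel (\<lambda>r. ennreal pi * indicator {0..} r)"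
proof (rule measure_eqI_generator_eq[where E = "range atMost" and \<Omega> = UNIV and A = "\<lambda>i. {..real i}"])
  show "Int_stable (range (atMost :: real \<Rightarrow> real set))"
    by (auto simp: Int_stable_def)
  have ball: "emeasure (distr lborel borel (\<lambda>x::complex. (norm x)\<^sup>2)) {..t} = ennreal (pi * max 0 t)" for t
  proof -
    have "(\<lambda>x::complex. (norm x)\<^sup>2) -` {..t} = (if t < 0 then {} else cball 0 (sqrt t))"
    proof (cases "t < 0")
      case True
      then have "\<not> (norm x)\<^sup>2 \<le> t" for x :: complex
        using zero_le_power2[of "norm x"] by linarith
      then show ?thesis using True by auto
    next
      case False
      then have "(norm x)\<^sup>2 \<le> t \<longleftrightarrow> norm x \<le> sqrt t" for x :: complex
        by (metis norm_ge_zero not_less real_sqrt_le_iff real_sqrt_unique)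
      then show ?thesis using False by auto
    qed
    then show ?thesis
      by (simp add: emeasure_distr emeasure_cball unit_ball_vol_numeral max_def)
  qed
  show "emeasure (distr lborel borel (\<lambda>x::complex. (norm x)\<^sup>2)) X =
      emeasure (density lborel (\<lambda>r. ennreal pi * indicator {0..} r)) X" if X: "X \<in> range atMost" for X
  proof -
    obtain t where X: "X = {..t}" using X by auto
    have "emeasure (density lborel (\<lambda>r. ennreal pi * indicator {0..} r)) X =
        (\<integral>\<^sup>+r. ennreal pi * indicator {0..t} r \<partial>lborel)"
      by (auto simp: emeasure_density X indicator_def intro!: nn_integral_cong)
    also have "\<dots> = ennreal (pi * max 0 t)"
      by (simp add: nn_integral_cmult max_def ennreal_mult' emeasure_lborel_Icc_eq)
    finally show ?thesis by (simp add: ball X)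
  qed
  show "emeasure (distr lborel borel (\<lambda>x::complex. (norm x)\<^sup>2)) {..real i} \<noteq> \<infinity>" for i
    by (simp add: ball)
  show "(\<Union>i. {..real i}) = UNIV"
    using real_arch_simple by auto
qed (auto simp: borel_eq_atMost)

lemma nn_integral_factor_weight_moment:
  assumes "k < N"
  shows "(\<integral>\<^sup>+x. ennreal (norm x ^ (2 * k) * factor_weight m N x) \<partial>lborel) =
    ennreal (pi * (fact (m + k) * fact (N - k - 1) / fact (m + N)))"
proof -
  \<comment> \<open>With this \<open>q\<close> the exponent m+N+1 becomes (m+k)+q+2, as in the Beta
    integral. The bound \<open>k < N\<close> prevents truncation in the subtraction.\<close>
  define q where "q = N - k - 1"
  have N: "N = k + q + 1" using assms by (simp add: q_def)
  have "(\<integral>\<^sup>+x. ennreal (norm x ^ (2 * k) * factor_weight m N x) \<partial>lborel) =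
      (\<integral>\<^sup>+x. ennreal (((norm (x::complex))\<^sup>2) ^ (m + k) / (1 + (norm x)\<^sup>2) ^ (m + k + q + 2)) \<partial>lborel)"
    by (simp add: factor_weight_def N power_mult[symmetric] power_add[symmetric] algebra_simps)
  also have "\<dots> = (\<integral>\<^sup>+r. ennreal (r ^ (m + k) / (1 + r) ^ (m + k + q + 2))
      \<partial>distr lborel borel (\<lambda>x::complex. (norm x)\<^sup>2))"
    by (subst nn_integral_distr) auto
  also have "\<dots> = (\<integral>\<^sup>+r. ennreal pi * ennreal (indicator {0..} r * (r ^ (m + k) / (1 + r) ^ (m + k + q + 2))) \<partial>lborel)"
    unfolding distr_complex_norm_square
    by (subst nn_integral_density) (auto intro!: nn_integral_cong simp: indicator_def)
  also have "\<dots> = ennreal pi * ennreal (fact (m + k) * fact q / fact (m + k + q + 1))"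
  proof (subst nn_integral_cmult)
    have "has_bochner_integral lborel (\<lambda>r::real. indicator {0..} r * (r ^ (m + k) / (1 + r) ^ (m + k + q + 2)))
        (fact (m + k) * fact q / fact (m + k + q + 1))"
      by (rule has_bochner_integral_radial)
    then show "ennreal pi * (\<integral>\<^sup>+r. ennreal (indicator {0..} r * (r ^ (m + k) / (1 + r) ^ (m + k + q + 2))) \<partial>lborel) =
        ennreal pi * ennreal (fact (m + k) * fact q / fact (m + k + q + 1))"
      by (subst nn_integral_eq_integral)
         (auto intro!: AE_I2 simp: indicator_def has_bochner_integral_iff)
  qed auto
  finally show ?thesis
    by (simp add: N ennreal_mult'[symmetric] add_ac)
qed

section \<open>Moments of the product weight\<close>

text \<open>The squared norm of the monomial of degree \<open>k\<close> in closed form, identified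
  with the integral for \<open>k < N\<close>. Truncated subtraction keeps the expression positive
  for every \<open>k\<close>.\<close>

definition weight_moment :: "nat \<Rightarrow> nat \<Rightarrow> (nat \<Rightarrow> nat) \<Rightarrow> nat \<Rightarrow> real" where
  "weight_moment n N \<nu> k =
     pi ^ n * (\<Prod>j=1..n. fact (\<nu> j + k) * fact (N - k - 1) / fact (\<nu> j + N))"

lemma weight_moment_pos: "0 < weight_moment n N \<nu> k"
  by (auto simp: weight_moment_def intro!: mult_pos_pos prod_pos divide_pos_pos)

text \<open>\<open>weight_delta\<close> lifts the integral to the product space. There |x_1 ...
  x_n|^(2k) splits over the coordinates, leaving a product of one-variable moments.\<close>

lemma nn_integral_weight_moment:
  assumes "1 \<le> n" "k < N"
  shows "(\<integral>\<^sup>+z. ennreal (norm z ^ (2 * k) * weight n N \<nu> z) \<partial>lborel) = ennreal (weight_moment n N \<nu> k)"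
proof -
  interpret product_sigma_finite "\<lambda>_::nat. lborel :: complex measure" by standard
  have "(\<integral>\<^sup>+z. ennreal (norm z ^ (2 * k) * weight n N \<nu> z) \<partial>lborel) =
      (\<integral>\<^sup>+z. ennreal (norm z ^ (2 * k)) * ennreal (weight n N \<nu> z) \<partial>lborel)"
    by (simp add: ennreal_mult')
  also have "\<dots> = (\<integral>\<^sup>+x. ennreal (norm (\<Prod>j=1..n. x j) ^ (2 * k)) *
      ennreal (\<Prod>j=1..n. factor_weight (\<nu> j) N (x j)) \<partial>(\<Pi>\<^sub>M j\<in>{1..n}. lborel))"
    using assms by (intro weight_delta) auto
  also have "\<dots> = (\<integral>\<^sup>+x. (\<Prod>j\<in>{1..n}. ennreal (norm (x j) ^ (2 * k) * factor_weight (\<nu> j) N (x j)))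
      \<partial>(\<Pi>\<^sub>M j\<in>{1..n}. lborel))"
  proof (rule nn_integral_cong)
    fix x :: "nat \<Rightarrow> complex"
    have "norm (\<Prod>j=1..n. x j) ^ (2 * k) = (\<Prod>j=1..n. norm (x j) ^ (2 * k))"
      by (simp only: prod_norm[symmetric] prod_power_distrib)
    then show "ennreal (norm (\<Prod>j=1..n. x j) ^ (2 * k)) *
        ennreal (\<Prod>j=1..n. factor_weight (\<nu> j) N (x j)) =
        (\<Prod>j\<in>{1..n}. ennreal (norm (x j) ^ (2 * k) * factor_weight (\<nu> j) N (x j)))"
      by (subst prod_ennreal) (simp_all only: prod.distrib ennreal_mult' prod_nonneg zero_le_power
          norm_ge_zero factor_weight_nonneg mult_nonneg_nonneg)
  qed
  also have "\<dots> = (\<Prod>j\<in>{1..n}. \<integral>\<^sup>+x. ennreal (norm x ^ (2 * k) * factor_weight (\<nu> j) N x) \<partial>lborel)"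
    by (rule product_nn_integral_prod) auto
  also have "\<dots> = (\<Prod>j\<in>{1..n}. ennreal (pi * (fact (\<nu> j + k) * fact (N - k - 1) / fact (\<nu> j + N))))"
    using assms by (simp only: nn_integral_factor_weight_moment)
  also have "\<dots> = ennreal (weight_moment n N \<nu> k)"
    by (subst prod_ennreal) (auto simp: weight_moment_def prod.distrib simp del: times_divide_eq_right)
  finally show ?thesis .
qed

section \<open>Rotation invariance and orthogonality of monomials\<close>

lemma weight_nonneg: "0 \<le> weight n N \<nu> z"
  unfolding weight_def by (intro integral_nonneg_AE AE_I2) (auto intro!: prod_nonneg mult_nonneg_nonneg divide_nonneg_nonneg simp del: times_divide_eq_left)

lemma borel_measurable_weight [measurable]: "weight n N \<nu> \<in> borel_measurable borel"
proof -
  interpret M: finite_product_sigma_finite "\<lambda>_::nat. lborel :: complex measure" "{2..n}"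
    by standard auto
  show ?thesis
    unfolding weight_def
    by (rule M.borel_measurable_lebesgue_integral) measurable
qed

text \<open>The variable \<open>z\<close> enters the defining integral only through the norm of a
  quotient.\<close>

lemma weight_rotate: "norm c = 1 \<Longrightarrow> weight n N \<nu> (c * z) = weight n N \<nu> z"
  by (simp add: weight_def factor_weight_def norm_mult norm_divide)

lemma borel_measurable_cnj [measurable]: "cnj \<in> borel_measurable borel"
  by (intro borel_measurable_continuous_onI continuous_intros)

text \<open>Multiplication by \<open>c\<close> has real Jacobian |c|^2 = 1; the change of variables
  is applied to indicator functions.\<close>

lemma lborel_complex_rotate:
  assumes "norm c = 1"
  shows "distr lborel borel ((*) c) = (lborel :: complex measure)"
proof (rule measure_eqI)
  fix A assume "A \<in> sets (distr lborel borel ((*) c))"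
  then have [measurable]: "A \<in> sets borel" by simp
  have "emeasure lborel A = (\<integral>\<^sup>+x. indicator A x \<partial>lborel)" by simp
  also have "\<dots> = (\<integral>\<^sup>+x. indicator A (c * x) \<partial>lborel)"
    using assms by (subst nn_integral_complex_mult[of _ c]) auto
  also have "\<dots> = (\<integral>\<^sup>+x. indicator A x \<partial>distr lborel borel ((*) c))"
    by (subst nn_integral_distr) auto
  also have "\<dots> = emeasure (distr lborel borel ((*) c)) A" by simp
  finally show "emeasure (distr lborel borel ((*) c)) A = emeasure lborel A" ..
qed simp

lemma integrable_weight_even:
  assumes "1 \<le> n" "k < N"
  shows "integrable lborel (\<lambda>z. norm z ^ (2 * k) * weight n N \<nu> z)"
  using nn_integral_weight_moment[OF assms, of \<nu>]
  by (intro integrableI_nonneg) (auto simp: weight_nonneg)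

lemma integral_weight_even:
  assumes "1 \<le> n" "k < N"
  shows "(LINT z|lborel. norm z ^ (2 * k) * weight n N \<nu> z) = weight_moment n N \<nu> k"
  using nn_integral_weight_moment[OF assms, of \<nu>] weight_moment_pos[of n N \<nu> k]
  by (subst integral_eq_nn_integral) (auto simp: weight_nonneg)

text \<open>The modulus |z|^(k+l) is at most |z|^(2k) + |z|^(2l), and both of these moments are
  finite because \<open>k\<close> and \<open>l\<close> lie below \<open>N\<close>.\<close>

lemma integrable_weight_monomial:
  assumes "1 \<le> n" "k < N" "l < N"
  shows "integrable lborel (\<lambda>z. z ^ k * cnj z ^ l * complex_of_real (weight n N \<nu> z))"
proof (rule Bochner_Integration.integrable_bound)
  show "integrable lborel (\<lambda>z. norm z ^ (2 * k) * weight n N \<nu> z + norm z ^ (2 * l) * weight n N \<nu> z)"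
    using assms by (intro Bochner_Integration.integrable_add integrable_weight_even)
  show "AE z in lborel. norm (z ^ k * cnj z ^ l * complex_of_real (weight n N \<nu> z)) \<le>
      norm (norm z ^ (2 * k) * weight n N \<nu> z + norm z ^ (2 * l) * weight n N \<nu> z)"
  proof (rule AE_I2)
    fix z :: complex
    have "0 \<le> norm z ^ k" "0 \<le> norm z ^ l" by auto
    then have "norm z ^ k * norm z ^ l \<le> (norm z ^ k)\<^sup>2 + (norm z ^ l)\<^sup>2"
      using sum_squares_bound[of "norm z ^ k" "norm z ^ l"]
        mult_nonneg_nonneg[of "norm z ^ k" "norm z ^ l"] unfolding mult.assoc by linarith
    then have "norm z ^ k * norm z ^ l * weight n N \<nu> z \<le>
        (norm z ^ (2 * k) + norm z ^ (2 * l)) * weight n N \<nu> z"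
      by (intro mult_right_mono weight_nonneg) (simp_all add: power_mult[symmetric] mult.commute)
    then show "norm (z ^ k * cnj z ^ l * complex_of_real (weight n N \<nu> z)) \<le>
        norm (norm z ^ (2 * k) * weight n N \<nu> z + norm z ^ (2 * l) * weight n N \<nu> z)"
      by (simp add: norm_mult norm_power weight_nonneg distrib_right)
  qed
qed measurable

lemma integral_weight_monomial_distinct:
  assumes "k \<noteq> l"
  shows "(LINT z|lborel. z ^ k * cnj z ^ l * complex_of_real (weight n N \<nu> z)) = 0"
proof -
  \<comment> \<open>The angle is chosen so that c^(k-l) = cis pi = -1. The difference is taken in
    the reals, so it may be negative.\<close>
  define c where "c = cis (pi / (real k - real l))"
  define I where "I = (LINT z|lborel. z ^ k * cnj z ^ l * complex_of_real (weight n N \<nu> z))"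
  \<comment> \<open>Rotating the plane by \<open>c\<close> multiplies the integral by \<open>-1\<close>.\<close>
  have c: "norm c = 1" by (simp add: c_def)
  have "c ^ k * cnj c ^ l = cis ((real k - real l) * (pi / (real k - real l)))"
    by (simp add: c_def Complex.DeMoivre cis_cnj cis_mult diff_divide_distrib left_diff_distrib)
  also have "\<dots> = -1" using assms by simp
  finally have c': "c ^ k * cnj c ^ l = -1" .
  have "I = (LINT z|distr lborel borel ((*) c). z ^ k * cnj z ^ l * complex_of_real (weight n N \<nu> z))"
    using c by (simp add: lborel_complex_rotate I_def)
  \<comment> \<open>This substitution and the later extraction of the sign hold for Bochner
    integrals in general, a divergent one having value 0, so all degrees are covered.\<close>
  also have "\<dots> = (LINT z|lborel. (c * z) ^ k * cnj (c * z) ^ l * complex_of_real (weight n N \<nu> (c * z)))"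
    by (subst integral_distr) auto
  also have "\<dots> = (LINT z|lborel. (c ^ k * cnj c ^ l) * (z ^ k * cnj z ^ l * complex_of_real (weight n N \<nu> z)))"
    unfolding weight_rotate[OF c] by (simp add: power_mult_distrib mult_ac)
  also have "\<dots> = - I"
    by (simp add: c' I_def)
  finally show ?thesis by (simp add: I_def)
qed

lemma integral_weight_monomial:
  assumes "1 \<le> n" "k < N"
  shows "(LINT z|lborel. z ^ k * cnj z ^ l * complex_of_real (weight n N \<nu> z)) =
    (if k = l then of_real (weight_moment n N \<nu> k) else 0)"
proof (cases "k = l")
  case True
  have "z ^ k * cnj z ^ k = of_real (norm z ^ (2 * k))" for z :: complex
    by (simp add: power_mult_distrib[symmetric] complex_norm_square[symmetric] power_mult)
  then have "(LINT z|lborel. z ^ k * cnj z ^ k * complex_of_real (weight n N \<nu> z)) =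
      (LINT z|lborel. complex_of_real (norm z ^ (2 * k) * weight n N \<nu> z))"
    by simp
  also have "\<dots> = of_real (weight_moment n N \<nu> k)"
    using assms by (simp only: integral_complex_of_real integral_weight_even)
  finally show ?thesis using True by simp
qed (simp add: integral_weight_monomial_distinct)

section \<open>Orthonormal polynomials are monomials\<close>

text \<open>Orthogonality of monomials removes every term of \<open>f\<close> except the one of
  degree \<open>l\<close>. Orthogonality relations thereby become statements about
  coefficients.\<close>

lemma integral_weight_poly_monomial:
  assumes "1 \<le> n" "degree f < N" "l < N"
  shows "(LINT z|lborel. poly f z * cnj z ^ l * complex_of_real (weight n N \<nu> z)) =
    coeff f l * of_real (weight_moment n N \<nu> l)"
proof -
  have "(LINT z|lborel. poly f z * cnj z ^ l * complex_of_real (weight n N \<nu> z)) =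
      (LINT z|lborel. (\<Sum>i\<le>degree f. coeff f i * (z ^ i * cnj z ^ l * complex_of_real (weight n N \<nu> z))))"
    by (simp add: poly_altdef sum_distrib_right mult.assoc)
  also have "\<dots> = (\<Sum>i\<le>degree f. coeff f i *
      (LINT z|lborel. z ^ i * cnj z ^ l * complex_of_real (weight n N \<nu> z)))"
    using assms by (subst Bochner_Integration.integral_sum) (auto intro!: integrable_mult_right integrable_weight_monomial)
  also have "\<dots> = (\<Sum>i\<le>degree f. if i = l then coeff f i * of_real (weight_moment n N \<nu> i) else 0)"
    using assms by (intro sum.cong) (auto simp: integral_weight_monomial)
  \<comment> \<open>If \<open>l\<close> exceeds the degree of \<open>f\<close>, no summand matches
    and the coefficient is 0 as well.\<close>
  also have "\<dots> = coeff f l * of_real (weight_moment n N \<nu> l)"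
    by (auto simp: coeff_eq_0)
  finally show ?thesis .
qed

text \<open>Orthonormality fixes the leading coefficient only up to a phase, hence the existential
  \<open>a\<close> with a condition on \<open>a * cnj a\<close> alone.\<close>

lemma orthonormal_polys_weight_monom:
  assumes n: "1 \<le> n" and p: "orthonormal_polys (weight n N \<nu>) N p" and "k < N"
  shows "\<exists>a. p k = monom a k \<and> a * cnj a * of_real (weight_moment n N \<nu> k) = 1"
  using \<open>k < N\<close>
proof (induction k rule: less_induct)
  case (less k)
  have deg: "degree (p k) = k" using p less.prems by (simp add: orthonormal_polys_def)
  have orth: "(LINT z|lborel. poly (p k) z * cnj (poly (p l) z) * complex_of_real (weight n N \<nu> z)) =
      (if k = l then 1 else 0)" if "l < N" for l
    using p less.prems that by (simp add: orthonormal_polys_def)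
  \<comment> \<open>Used twice: for \<open>l < k\<close>, where the induction hypothesis makes
    \<open>p l\<close> a monomial, and for \<open>l = k\<close> once \<open>p k\<close> itself is
    known to be one.\<close>
  have int: "(LINT z|lborel. poly (p k) z * cnj (poly (p l) z) * complex_of_real (weight n N \<nu> z)) =
      cnj b * (coeff (p k) l * of_real (weight_moment n N \<nu> l))" if "p l = monom b l" "l < N" for l b
  proof -
    have "(LINT z|lborel. poly (p k) z * cnj (poly (p l) z) * complex_of_real (weight n N \<nu> z)) =
        (LINT z|lborel. cnj b * (poly (p k) z * cnj z ^ l * complex_of_real (weight n N \<nu> z)))"
      by (simp add: that poly_monom mult_ac)
    then show ?thesis
      using n less.prems deg that by (simp add: integral_weight_poly_monomial)
  qed
  \<comment> \<open>Below \<open>k\<close> the coefficient vanishes by orthogonality to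
    \<open>p l\<close>, whose own coefficient \<open>b\<close> is nonzero; above \<open>k\<close> it
    vanishes by the degree.\<close>
  have "coeff (p k) l = 0" if "l \<noteq> k" for l
  proof (cases "l < k")
    case True
    with less obtain b where b: "p l = monom b l" "b * cnj b * of_real (weight_moment n N \<nu> l) = 1"
      by (meson order.strict_trans)
    have "cnj b * (coeff (p k) l * of_real (weight_moment n N \<nu> l)) = 0"
      using orth[of l] int[OF b(1)] True less.prems by simp
    moreover have "b \<noteq> 0" using b(2) by auto
    ultimately show ?thesis
      using weight_moment_pos[of n N \<nu> l] by simp
  qed (use that deg in \<open>simp add: coeff_eq_0\<close>)
  then have mon: "p k = monom (coeff (p k) k) k"
    by (intro poly_eqI) (auto simp: coeff_monom)
  have "coeff (p k) k * cnj (coeff (p k) k) * of_real (weight_moment n N \<nu> k) = 1"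
    using int[OF mon less.prems] orth[OF less.prems] by (simp add: mult_ac)
  with mon show ?case by blast
qed

text \<open>The undetermined phases cancel, since each summand contains only
  \<open>a * cnj a\<close>.\<close>

lemma sum_orthonormal_polys_weight:
  assumes "1 \<le> n" "orthonormal_polys (weight n N \<nu>) N p"
  shows "(\<Sum>k<N. poly (p k) z * cnj (poly (p k) w)) =
    (\<Sum>k<N. (z * cnj w) ^ k / of_real (weight_moment n N \<nu> k))"
proof (rule sum.cong)
  fix k assume "k \<in> {..<N}"
  with orthonormal_polys_weight_monom[OF assms] obtain a
    where a: "p k = monom a k" "a * cnj a * of_real (weight_moment n N \<nu> k) = 1" by auto
  have "poly (p k) z * cnj (poly (p k) w) = a * cnj a * (z * cnj w) ^ k"
    by (simp add: a(1) poly_monom power_mult_distrib mult_ac)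
  also have "a * cnj a = 1 / of_real (weight_moment n N \<nu> k)"
    using a(2) weight_moment_pos[of n N \<nu> k] by (simp add: field_simps)
  finally show "poly (p k) z * cnj (poly (p k) w) = (z * cnj w) ^ k / of_real (weight_moment n N \<nu> k)"
    by simp
qed simp

section \<open>Pochhammer symbols and the terminating series\<close>

text \<open>The factors are the negatives of n, n-1, ..., n-k+1. With the denominator cleared, each
  induction step absorbs the new factor -(n-k) into \<open>fact (n - k)\<close> and flips the
  sign.\<close>

lemma pochhammer_neg_of_nat:
  assumes "k \<le> n"
  shows "pochhammer (- of_nat n :: 'a :: field_char_0) k = (-1) ^ k * fact n / fact (n - k)"
proof -
  have "pochhammer (- of_nat n :: 'a) k * fact (n - k) = (-1) ^ k * fact n"
    using assms
  proof (induction k)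
    case (Suc k)
    then have *: "n - k = Suc (n - Suc k)" by simp
    have "- of_nat n + of_nat k = (- of_nat (n - k) :: 'a)"
      using Suc.prems by (simp add: of_nat_diff)
    then have "pochhammer (- of_nat n :: 'a) (Suc k) * fact (n - Suc k) =
        - (pochhammer (- of_nat n :: 'a) k * fact (n - k))"
      unfolding pochhammer_Suc by (simp add: * mult_ac del: of_nat_Suc)
    with Suc show ?case by simp
  qed simp
  then show ?thesis by (simp add: field_simps)
qed

lemma pochhammer_of_nat_plus_1:
  "pochhammer (of_nat m + 1 :: 'a :: field_char_0) k = fact (m + k) / fact m"
proof -
  have "(fact (m + k) :: 'a) = fact m * pochhammer (of_nat m + 1) k"
    using pochhammer_product'[of "1 :: 'a" m k] by (simp add: pochhammer_fact[symmetric] add.commute)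
  then show ?thesis by simp
qed

text \<open>The upper parameter 1-N is -(N-1), so its Pochhammer symbol contains the factor 0 from
  \<open>k = N\<close> on and the series terminates.\<close>

lemma hypergeometric_neg_of_nat:
  assumes "1 \<le> n" "1 \<le> N"
  shows "hypergeometric (replicate n (1 - of_nat N)) bs x =
    (\<Sum>k<N. ((-1) ^ k * fact (N - 1) / fact (N - k - 1)) ^ n / (\<Prod>b\<leftarrow>bs. pochhammer b k) * x ^ k / fact k)"
proof -
  have N: "(1 - of_nat N :: complex) = - of_nat (N - 1)"
    using assms by (simp add: of_nat_diff)
  have "hypergeometric (replicate n (1 - of_nat N)) bs x =
      (\<Sum>k<N. pochhammer (1 - of_nat N) k ^ n / (\<Prod>b\<leftarrow>bs. pochhammer b k) * x ^ k / fact k)"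
    unfolding hypergeometric_altdef map_replicate prod_list_replicate
  proof (rule suminf_finite)
    fix k assume "k \<notin> {..<N}"
    then have "pochhammer (1 - of_nat N :: complex) k = 0"
      unfolding N using assms by (intro pochhammer_of_nat_eq_0_lemma) auto
    \<comment> \<open>Here \<open>1 \<le> n\<close> matters: the vanishing symbol is raised to the
      power \<open>n\<close>.\<close>
    then show "pochhammer (1 - of_nat N) k ^ n / (\<Prod>b\<leftarrow>bs. pochhammer b k) * x ^ k / fact k = 0"
      using assms by simp
  qed simp
  also have "\<dots> = (\<Sum>k<N. ((-1) ^ k * fact (N - 1) / fact (N - k - 1)) ^ n /
      (\<Prod>b\<leftarrow>bs. pochhammer b k) * x ^ k / fact k)"
  proof (intro sum.cong)
    fix k assume "k \<in> {..<N}"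
    then have "pochhammer (1 - of_nat N :: complex) k = (-1) ^ k * fact (N - 1) / fact (N - k - 1)"
      unfolding N by (subst pochhammer_neg_of_nat) (auto simp: diff_commute)
    then show "pochhammer (1 - of_nat N) k ^ n / (\<Prod>b\<leftarrow>bs. pochhammer b k) * x ^ k / fact k =
        ((-1) ^ k * fact (N - 1) / fact (N - k - 1)) ^ n / (\<Prod>b\<leftarrow>bs. pochhammer b k) * x ^ k / fact k"
      by simp
  qed simp
  finally show ?thesis .
qed

text \<open>Separates 1/h_k into the prefactor of the kernel, free of \<open>k\<close>, and the
  hypergeometric coefficient without its sign.\<close>

lemma inverse_weight_moment:
  assumes n: "1 \<le> n" and N: "1 \<le> N" and \<nu>: "\<nu> 1 = 0"
  shows "1 / complex_of_real (weight_moment n N \<nu> k) =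
    of_real ((\<Prod>i=1..n. pochhammer (real (\<nu> i) + 1) N) / (pi ^ n * Gamma (real N) ^ n)) *
    ((fact (N - 1) / fact (N - k - 1)) ^ n /
      (\<Prod>b\<leftarrow>map (\<lambda>i. 1 + of_nat (\<nu> i)) [2..<n + 1]. pochhammer b k) / fact k)"
proof -
  have G: "Gamma (real N) = fact (N - 1)"
    using Gamma_fact[of "N - 1", where 'a = real] N by (simp add: of_nat_diff)
  have "(\<Prod>b\<leftarrow>map (\<lambda>i. 1 + of_nat (\<nu> i)) [2..<n + 1]. pochhammer b k) * fact k =
      (\<Prod>i\<in>{2..n}. pochhammer (of_nat (\<nu> i) + 1 :: complex) k) * fact k"
    by (simp add: prod.distinct_set_conv_list[symmetric] o_def add_ac del: upt_Suc
          flip: atLeastLessThanSuc_atLeastAtMost)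
  \<comment> \<open>The lower parameters run over the indices 2 to \<open>n\<close>. As
    \<open>\<nu> 1 = 0\<close>, the symbol at index 1 is (1)_k = k!, so the factorial of the series
    fills the missing slot.\<close>
  also have "\<dots> = (\<Prod>i\<in>insert 1 {2..n}. pochhammer (of_nat (\<nu> i) + 1 :: complex) k)"
    using \<nu> by (simp add: pochhammer_fact)
  also have "insert 1 {2..n} = {1..n}" using n by auto
  finally have B: "(\<Prod>b\<leftarrow>map (\<lambda>i. 1 + of_nat (\<nu> i)) [2..<n + 1]. pochhammer b k) * fact k =
      (\<Prod>i=1..n. fact (\<nu> i + k) / fact (\<nu> i) :: complex)"
    by (simp add: pochhammer_of_nat_plus_1)
  define A B V :: complex
    where "A = (\<Prod>i=1..n. fact (\<nu> i + k))" and "B = (\<Prod>i=1..n. fact (\<nu> i + N))"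
      and "V = (\<Prod>i=1..n. fact (\<nu> i))"
  have nz: "A \<noteq> 0" "B \<noteq> 0" "V \<noteq> 0"
    by (auto simp: A_def B_def V_def)
  have "complex_of_real (weight_moment n N \<nu> k) = of_real pi ^ n * (A * fact (N - k - 1) ^ n / B)"
    by (simp add: weight_moment_def A_def B_def prod_dividef prod.distrib)
  \<comment> \<open>The factors \<open>V\<close> and \<open>fact (N - 1) ^ n\<close> are inserted so
    as to cancel. They turn the factorials into Pochhammer symbols and supply Gamma(N)^n.\<close>
  then have "(1 :: complex) / of_real (weight_moment n N \<nu> k) =
     ((B / V) / (of_real pi ^ n * fact (N - 1) ^ n)) *
     ((fact (N - 1) / fact (N - k - 1)) ^ n / (A / V))"
    using nz by (simp add: power_divide)
  then have "(1 :: complex) / of_real (weight_moment n N \<nu> k) =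
     ((\<Prod>i=1..n. fact (\<nu> i + N) / fact (\<nu> i)) / (of_real pi ^ n * fact (N - 1) ^ n)) *
     ((fact (N - 1) / fact (N - k - 1)) ^ n / (\<Prod>i=1..n. fact (\<nu> i + k) / fact (\<nu> i)))"
    by (simp only: A_def B_def V_def prod_dividef)
  moreover have "complex_of_real ((\<Prod>i=1..n. pochhammer (real (\<nu> i) + 1) N) / (pi ^ n * Gamma (real N) ^ n)) =
      (\<Prod>i=1..n. fact (\<nu> i + N) / fact (\<nu> i)) / (of_real pi ^ n * fact (N - 1) ^ n)"
    by (simp only: G pochhammer_of_nat_plus_1) simp
  ultimately show ?thesis
    by (simp only: divide_divide_eq_left B)
qed

section \<open>Matching the kernel with the series\<close>

theorem proposition4p1:
  fixes n N :: nat and \<nu> :: "nat \<Rightarrow> nat" and p :: "nat \<Rightarrow> complex poly" and z w :: complex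
  assumes "1 \<le> n" and "1 \<le> N"
    and "\<nu> 1 = 0" and "mono_on {1..n} \<nu>"
    and "orthonormal_polys (weight n N \<nu>) N p"
  shows "correlation_kernel n N \<nu> p z w =
    complex_of_real ((\<Prod>i=1..n. pochhammer (real (\<nu> i) + 1) N) / (pi ^ n * Gamma (real N) ^ n)
        * sqrt (weight n N \<nu> z * weight n N \<nu> w)) *
      hypergeometric (replicate n (1 - of_nat N))
        (map (\<lambda>i. 1 + of_nat (\<nu> i)) [2..<n + 1])
        ((-1) ^ n * z * cnj w)"
proof -
  define C where "C = complex_of_real
    ((\<Prod>i=1..n. pochhammer (real (\<nu> i) + 1) N) / (pi ^ n * Gamma (real N) ^ n))"
  define bs where "bs = map (\<lambda>i. 1 + complex_of_nat (\<nu> i)) [2..<n + 1]"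
  \<comment> \<open>The \<open>n\<close> upper parameters contribute (-1)^(kn) to the term of index
    \<open>k\<close>; the sign (-1)^n in the argument cancels it.\<close>
  have sgn: "((-1) ^ k * a / b) ^ n * ((-1) ^ n) ^ k = (a / b) ^ n" for k and a b :: complex
  proof -
    have "((-1) ^ k * a / b) ^ n * ((-1) ^ n) ^ k = ((-1) ^ (k * n) * (-1) ^ (k * n)) * (a / b) ^ n"
      by (simp add: power_mult_distrib power_divide power_mult[symmetric] mult.commute)
    also have "(-1) ^ (k * n) * (-1) ^ (k * n) = (1 :: complex)"
      by (simp add: power_add[symmetric])
    finally show ?thesis by simp
  qed
  have "(\<Sum>k<N. poly (p k) z * cnj (poly (p k) w)) =
      (\<Sum>k<N. (z * cnj w) ^ k * (1 / of_real (weight_moment n N \<nu> k)))"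
    using sum_orthonormal_polys_weight[OF assms(1,5)] by simp
  also have "\<dots> = (\<Sum>k<N. C * (((-1) ^ k * fact (N - 1) / fact (N - k - 1)) ^ n /
      (\<Prod>b\<leftarrow>bs. pochhammer b k) * ((-1) ^ n * z * cnj w) ^ k / fact k))"
  proof (rule sum.cong)
    fix k
    have "((-1) ^ n * z * cnj w) ^ k = ((-1) ^ n) ^ k * (z * cnj w) ^ k"
      by (simp add: power_mult_distrib)
    then have "((-1) ^ k * fact (N - 1) / fact (N - k - 1)) ^ n /
        (\<Prod>b\<leftarrow>bs. pochhammer b k) * ((-1) ^ n * z * cnj w) ^ k / fact k =
        (z * cnj w) ^ k * ((((-1) ^ k * fact (N - 1) / fact (N - k - 1)) ^ n * ((-1) ^ n) ^ k) /
        (\<Prod>b\<leftarrow>bs. pochhammer b k) / fact k)"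
      by (simp only: times_divide_eq_left times_divide_eq_right mult_ac)
    also note sgn
    finally show "(z * cnj w) ^ k * (1 / of_real (weight_moment n N \<nu> k)) =
        C * (((-1) ^ k * fact (N - 1) / fact (N - k - 1)) ^ n /
        (\<Prod>b\<leftarrow>bs. pochhammer b k) * ((-1) ^ n * z * cnj w) ^ k / fact k)"
      unfolding inverse_weight_moment[where \<nu> = \<nu>, OF assms(1-3)] C_def bs_def by (simp only: mult_ac)
  qed simp
  also have "\<dots> = C * hypergeometric (replicate n (1 - of_nat N)) bs ((-1) ^ n * z * cnj w)"
    by (simp only: hypergeometric_neg_of_nat[OF assms(1,2)] sum_distrib_left)
  finally show ?thesis
    unfolding correlation_kernel_def C_def bs_def of_real_mult by (simp only: mult_ac)
qed

end
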